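(* Let $\Omega\subseteq\mathbf{R}^m$ be a domain and let $f:\Omega\rightarrow\mathbf{R}^n$ be a continuously differentiable mapping. Let $\mathbf{w}:\Omega\to(0,\infty)$ be continuous, and let $\mathbf{W}:\Omega\times\Omega\to(0,\infty)$ be an admissible function for $\mathbf{w}$. Put $$\|f\|_{\mathbf{w}}^{\mathbf{b}}=\sup_{\zeta\in\Omega}\mathbf{w}(\zeta)\|Df(\zeta)\|,\qquad \|f\|_{\mathbf{W}}^{\mathbf{l}}=\sup_{\zeta,\eta\in\Omega,\ \zeta\ne\eta}\mathbf{W}(\zeta,\eta)\frac{|f(\zeta)-f(\eta)|}{|\zeta-\eta|}.$$ If one of the numbers $\|f\|_{\mathbf{w}}^{\mathbf{b}}$ and $\|f\|_{\mathbf{W}}^{\mathbf{l}}$ is finite, then both numbers are finite and equal.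
   Context: $|\cdot|$ is the Euclidean norm. A domain is a nonempty connected open set. $Df(\zeta)$ is the differential of $f$ at $\zeta$, and $\|Df(\zeta)\|=\sup_{|\ell|=1}|Df(\zeta)\ell|$ is its operator norm as a linear map $\mathbf{R}^m\to\mathbf{R}^n$. For a positive continuous function $\mathbf{w}$ on $\Omega$, the $\mathbf{w}$-distance is $$d_{\mathbf{w}}(\zeta,\eta)=\inf_\gamma\int_\gamma\frac{|d\omega|}{\mathbf{w}(\omega)},$$ where the infimum is over all piecewise smooth curves $\gamma\subseteq\Omega$ connecting $\zeta$ and $\eta$ (and $|d\omega|$ denotes arc length). A function $\mathbf{W}:\Omega\times\Omega\to(0,\infty)$ (everywhere positive) is called admissible for $\mathbf{w}$ if for every $\zeta,\eta\in\Omega$: ($W_1$) $\mathbf{W}(\zeta,\eta)=\mathbf{W}(\eta,\zeta)$; ($W_2$) $\mathbf{W}(\zeta,\zeta)=\mathbf{w}(\zeta)$; ($W_3$) $\liminf_{\eta\to\zeta}\mathbf{W}(\zeta,\eta)\ge\mathbf{W}(\zeta,\zeta)=\mathbf{w}(\zeta)$; ($W_4$) $d_{\mathbf{w}}(\zeta,\eta)\,\mathbf{W}(\zeta,\eta)\le|\zeta-\eta|$. *)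

theory Defs
  imports "HOL-Analysis.Analysis"
begin

definition is_domain :: "'a::euclidean_space set \<Rightarrow> bool" where
  "is_domain \<Omega> \<longleftrightarrow> \<Omega> \<noteq> {} \<and> open \<Omega> \<and> connected \<Omega>"

(* Continuity of the differential is with respect to the operator norm on bounded linear maps. *)
definition C1_map_on :: "('a::euclidean_space \<Rightarrow> 'b::euclidean_space) \<Rightarrow> 'a set \<Rightarrow> bool" where
  "C1_map_on f \<Omega> \<longleftrightarrow>
     (\<exists>f' :: 'a \<Rightarrow> 'a \<Rightarrow>\<^sub>L 'b.
        (\<forall>\<zeta>\<in>\<Omega>. (f has_derivative blinfun_apply (f' \<zeta>)) (at \<zeta>)) \<and> continuous_on \<Omega> f')"

(* On each closed piece the curve is C1 up to and including the endpoints (one-sided there).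
   The library's valid_path (piecewise_C1_differentiable_on) asks for no control of the derivative
   near the break points, so it also admits curves of infinite length, for which the
   Henstock-Kurzweil integral below would take the default value 0. *)
definition piecewise_smooth_curve :: "(real \<Rightarrow> 'a::euclidean_space) \<Rightarrow> bool" where
  "piecewise_smooth_curve \<gamma> \<longleftrightarrow>
     (\<exists>(n::nat) (p::nat \<Rightarrow> real). p 0 = 0 \<and> p n = 1 \<and>
        (\<forall>i<n. p i < p (Suc i) \<and>
           (\<exists>D. continuous_on {p i..p (Suc i)} D \<and>
                (\<forall>t\<in>{p i..p (Suc i)}.
                   (\<gamma> has_vector_derivative D t) (at t within {p i..p (Suc i)})))))"

(* vector_derivative is unspecified at the finitely many corners (and at 0 and 1), which does not
   affect the integral. *)
definition weighted_length :: "('a::euclidean_space \<Rightarrow> real) \<Rightarrow> (real \<Rightarrow> 'a) \<Rightarrow> real" where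
  "weighted_length w \<gamma> =
     integral {0..1} (\<lambda>t. norm (vector_derivative \<gamma> (at t)) / w (\<gamma> t))"

(* In a domain the set of lengths is nonempty, and it is bounded below by 0, so this real infimum
   is the true one. *)
definition weighted_dist ::
    "'a::euclidean_space set \<Rightarrow> ('a \<Rightarrow> real) \<Rightarrow> 'a \<Rightarrow> 'a \<Rightarrow> real" where
  "weighted_dist \<Omega> w \<zeta> \<eta> =
     Inf {weighted_length w \<gamma> | \<gamma>. piecewise_smooth_curve \<gamma> \<and> path_image \<gamma> \<subseteq> \<Omega> \<and>
                                 pathstart \<gamma> = \<zeta> \<and> pathfinish \<gamma> = \<eta>}"

definition admissible ::
    "'a::euclidean_space set \<Rightarrow> ('a \<Rightarrow> real) \<Rightarrow> ('a \<Rightarrow> 'a \<Rightarrow> real) \<Rightarrow> bool" where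
  "admissible \<Omega> w W \<longleftrightarrow>
     (\<forall>\<zeta>\<in>\<Omega>. \<forall>\<eta>\<in>\<Omega>. W \<zeta> \<eta> > 0) \<and>
     (\<forall>\<zeta>\<in>\<Omega>. \<forall>\<eta>\<in>\<Omega>. W \<zeta> \<eta> = W \<eta> \<zeta>) \<and>
     (\<forall>\<zeta>\<in>\<Omega>. W \<zeta> \<zeta> = w \<zeta>) \<and>
     (\<forall>\<zeta>\<in>\<Omega>. Liminf (at \<zeta> within \<Omega>) (\<lambda>\<eta>. ereal (W \<zeta> \<eta>)) \<ge> ereal (W \<zeta> \<zeta>)) \<and>
     (\<forall>\<zeta>\<in>\<Omega>. \<forall>\<eta>\<in>\<Omega>. weighted_dist \<Omega> w \<zeta> \<eta> * W \<zeta> \<eta> \<le> norm (\<zeta> - \<eta>))"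

definition bloch_norm ::
    "'a::euclidean_space set \<Rightarrow> ('a \<Rightarrow> real) \<Rightarrow> ('a \<Rightarrow> 'b::euclidean_space) \<Rightarrow> ereal" where
  "bloch_norm \<Omega> w f = (SUP \<zeta>\<in>\<Omega>. ereal (w \<zeta> * onorm (frechet_derivative f (at \<zeta>))))"

definition lipschitz_norm ::
    "'a::euclidean_space set \<Rightarrow> ('a \<Rightarrow> 'a \<Rightarrow> real) \<Rightarrow> ('a \<Rightarrow> 'b::euclidean_space) \<Rightarrow> ereal" where
  "lipschitz_norm \<Omega> W f =
     (SUP (\<zeta>, \<eta>)\<in>{(\<zeta>, \<eta>). \<zeta> \<in> \<Omega> \<and> \<eta> \<in> \<Omega> \<and> \<zeta> \<noteq> \<eta>}.
        ereal (W \<zeta> \<eta> * (norm (f \<zeta> - f \<eta>) / norm (\<zeta> - \<eta>))))"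

end

theory Submission
  imports Defs
begin

text \<open>
  The two norms are compared through their real upper bounds, and the two inequalities rest on
  different parts of admissibility.

  The Bloch norm is at most the Lipschitz norm for a local reason. Near a point \<open>\<zeta>\<close>, the
  condition on the lower limit makes \<open>W \<zeta> \<eta>\<close> exceed any \<open>c < w \<zeta>\<close>, so a bound \<open>L\<close> on the Lipschitz norm
  makes the difference quotients of \<open>f\<close> at \<open>\<zeta>\<close> at most \<open>L / c\<close>. The differential inherits this
  bound (\<open>onorm_derivative_le_of_eventually_lipschitz\<close>), and \<open>c\<close> may tend to \<open>w \<zeta>\<close>.

  Conversely, if \<open>w \<zeta> * \<parallel>Df \<zeta>\<parallel> \<le> B\<close> throughout the domain, then integrating the derivative of
  \<open>f \<circ> \<gamma>\<close> along a curve \<open>\<gamma>\<close> from \<open>\<zeta>\<close> to \<open>\<eta>\<close> bounds \<open>norm (f \<zeta> - f \<eta>)\<close> by \<open>B\<close> times the weighted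
  length of \<open>\<gamma>\<close> (\<open>norm_diff_le_weighted_length\<close>). Passing to the infimum over \<open>\<gamma>\<close> replaces that length
  by the weighted distance, which the last admissibility condition bounds by
  \<open>norm (\<zeta> - \<eta>) / W \<zeta> \<eta>\<close>.

  Thus the norms agree as extended reals, and finiteness of one is finiteness of the other.
\<close>

section \<open>Difference quotients and the differential\<close>

text \<open>
  Along a ray from \<open>x\<close> in direction \<open>l\<close>, both the increment of \<open>f\<close> and its linear approximation are
  proportional to the step up to an error of lower order, so a bound on the increments passes to the
  limit.
\<close>

lemma onorm_derivative_le_of_eventually_lipschitz:
  fixes f :: "'a::euclidean_space \<Rightarrow> 'b::real_normed_vector"
  assumes deriv: "(f has_derivative F) (at x)"
    and lip: "\<forall>\<^sub>F y in at x. norm (f y - f x) \<le> K * norm (y - x)"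
  shows "onorm F \<le> K"
proof (rule onorm_le)
  fix l
  interpret F: bounded_linear F
    using deriv by (rule has_derivative_bounded_linear)
  show "norm (F l) \<le> K * norm l"
  proof (cases "l = 0")
    case True
    then show ?thesis by (simp add: F.zero)
  next
    case False
    have "norm (F l) \<le> K * norm l + e" if "e > 0" for e
    proof -
      define \<epsilon> where "\<epsilon> = e / norm l"
      have "\<epsilon> > 0"
        using that False by (simp add: \<epsilon>_def)
      then obtain d1 where "d1 > 0" and d1:
        "\<And>y. norm (y - x) < d1 \<Longrightarrow> norm (f y - f x - F (y - x)) \<le> \<epsilon> * norm (y - x)"
        using deriv unfolding has_derivative_at_alt by blast
      obtain d2 where "d2 > 0" and d2:
        "\<And>y. y \<noteq> x \<Longrightarrow> dist y x < d2 \<Longrightarrow> norm (f y - f x) \<le> K * norm (y - x)"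
        using lip unfolding eventually_at by blast
      define t where "t = min d1 d2 / (2 * norm l)"
      have "t > 0"
        using \<open>d1 > 0\<close> \<open>d2 > 0\<close> False by (simp add: t_def)
      define y where "y = x + t *\<^sub>R l"
      have yx: "y - x = t *\<^sub>R l" "norm (y - x) = t * norm l" "y \<noteq> x"
        using \<open>t > 0\<close> False by (auto simp: y_def)
      have "t * norm l = min d1 d2 / 2"
        using False by (simp add: t_def)
      then have small: "norm (y - x) < d1" "dist y x < d2"
        using yx(2) \<open>d1 > 0\<close> \<open>d2 > 0\<close> by (auto simp: dist_norm)
      have "t * norm (F l) = norm (F (y - x))"
        using \<open>t > 0\<close> by (simp add: yx F.scaleR)
      also have "\<dots> \<le> norm (f y - f x) + norm (f y - f x - F (y - x))"
        by (metis norm_minus_commute norm_triangle_sub)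
      also have "\<dots> \<le> K * (t * norm l) + \<epsilon> * (t * norm l)"
        using d1[OF small(1)] d2[OF yx(3) small(2)] unfolding yx(2) by linarith
      also have "\<dots> = t * (K * norm l + e)"
        using False by (simp add: \<epsilon>_def field_simps)
      finally show ?thesis
        using \<open>t > 0\<close> by simp
    qed
    then show ?thesis by (rule field_le_epsilon)
  qed
qed

lemma bloch_norm_le_lipschitz_norm:
  fixes f :: "'a::euclidean_space \<Rightarrow> 'b::euclidean_space"
  assumes "open \<Omega>"
    and diff: "\<And>\<zeta>. \<zeta> \<in> \<Omega> \<Longrightarrow> f differentiable (at \<zeta>)"
    and w_pos: "\<And>\<zeta>. \<zeta> \<in> \<Omega> \<Longrightarrow> w \<zeta> > 0"
    and adm: "admissible \<Omega> w W"
  shows "bloch_norm \<Omega> w f \<le> lipschitz_norm \<Omega> W f"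
proof (rule ereal_le_real)
  fix L assume L: "lipschitz_norm \<Omega> W f \<le> ereal L"
  have quot: "W \<zeta> \<eta> * (norm (f \<zeta> - f \<eta>) / norm (\<zeta> - \<eta>)) \<le> L"
    if "\<zeta> \<in> \<Omega>" "\<eta> \<in> \<Omega>" "\<zeta> \<noteq> \<eta>" for \<zeta> \<eta>
    using L that unfolding lipschitz_norm_def SUP_le_iff by auto
  show "bloch_norm \<Omega> w f \<le> ereal L"
    unfolding bloch_norm_def
  proof (rule SUP_least)
    fix \<zeta> assume \<zeta>: "\<zeta> \<in> \<Omega>"
    let ?N = "onorm (frechet_derivative f (at \<zeta>))"
    have deriv: "(f has_derivative frechet_derivative f (at \<zeta>)) (at \<zeta>)"
      using diff[OF \<zeta>] by (simp add: frechet_derivative_works)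
    have lower: "c * ?N \<le> L" if c: "0 < c" "c < w \<zeta>" for c
    proof -
      have "ereal c < Liminf (at \<zeta> within \<Omega>) (\<lambda>\<eta>. ereal (W \<zeta> \<eta>))"
        using adm \<zeta> c unfolding admissible_def
        by (metis less_ereal.simps(1) less_le_trans)
      then have "\<forall>\<^sub>F \<eta> in at \<zeta> within \<Omega>. ereal c < ereal (W \<zeta> \<eta>)"
        by (rule less_LiminfD)
      then have W_large: "\<forall>\<^sub>F \<eta> in at \<zeta>. c < W \<zeta> \<eta>"
        using at_within_open[OF \<zeta> \<open>open \<Omega>\<close>] by simp
      have "\<forall>\<^sub>F \<eta> in at \<zeta>. \<eta> \<in> \<Omega> \<and> \<eta> \<noteq> \<zeta>"
        using \<open>open \<Omega>\<close> \<zeta> by (auto simp: eventually_at_topological)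
      with W_large have "\<forall>\<^sub>F \<eta> in at \<zeta>. norm (f \<eta> - f \<zeta>) \<le> L / c * norm (\<eta> - \<zeta>)"
      proof eventually_elim
        case (elim \<eta>)
        then have "\<zeta> \<noteq> \<eta>" by auto
        let ?q = "norm (f \<zeta> - f \<eta>) / norm (\<zeta> - \<eta>)"
        have "c * ?q \<le> W \<zeta> \<eta> * ?q"
          using elim by (intro mult_right_mono) auto
        also have "\<dots> \<le> L"
          using quot[OF \<zeta>, of \<eta>] elim by auto
        finally show ?case
          using c \<open>\<zeta> \<noteq> \<eta>\<close> by (simp add: field_simps norm_minus_commute)
      qed
      then have "?N \<le> L / c"
        by (rule onorm_derivative_le_of_eventually_lipschitz[OF deriv])
      then show ?thesis
        using c by (simp add: field_simps)
    qed
    have "w \<zeta> * ?N \<le> L"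
    proof (rule tendsto_upperbound)
      show "((\<lambda>c. c * ?N) \<longlongrightarrow> w \<zeta> * ?N) (at_left (w \<zeta>))"
        by (intro tendsto_intros)
      show "\<forall>\<^sub>F c in at_left (w \<zeta>). c * ?N \<le> L"
        using eventually_at_left_real[OF w_pos[OF \<zeta>]]
        by eventually_elim (auto intro: lower)
    qed simp
    then show "ereal (w \<zeta> * ?N) \<le> ereal L" by simp
  qed
qed

section \<open>Increments along piecewise smooth curves\<close>

text \<open>
  On a single smooth piece this is the fundamental theorem of calculus for \<open>f \<circ> \<gamma>\<close>. The weighted
  speed is integrable there because it agrees, off the two endpoints, with the continuous function
  built from \<open>D\<close>, the
  derivative within the piece.
\<close>

lemma norm_diff_le_weighted_length_piece:
  fixes f :: "'a::euclidean_space \<Rightarrow> 'b::euclidean_space" and \<gamma> :: "real \<Rightarrow> 'a"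
  assumes "a < b"
    and D_cont: "continuous_on {a..b} D"
    and D: "\<And>t. t \<in> {a..b} \<Longrightarrow> (\<gamma> has_vector_derivative D t) (at t within {a..b})"
    and \<gamma>_in: "\<gamma> ` {a..b} \<subseteq> \<Omega>"
    and f': "\<And>\<zeta>. \<zeta> \<in> \<Omega> \<Longrightarrow> (f has_derivative f' \<zeta>) (at \<zeta>)"
    and w_cont: "continuous_on \<Omega> w"
    and w_pos: "\<And>\<zeta>. \<zeta> \<in> \<Omega> \<Longrightarrow> w \<zeta> > 0"
    and B: "\<And>\<zeta>. \<zeta> \<in> \<Omega> \<Longrightarrow> w \<zeta> * onorm (f' \<zeta>) \<le> B"
  defines "h \<equiv> \<lambda>t. norm (vector_derivative \<gamma> (at t)) / w (\<gamma> t)"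
  shows "h integrable_on {a..b}"
    and "norm (f (\<gamma> b) - f (\<gamma> a)) \<le> B * integral {a..b} h"
proof -
  define k where "k = (\<lambda>t. norm (D t) / w (\<gamma> t))"
  have \<gamma>_cont: "continuous_on {a..b} \<gamma>"
    using D by (meson continuous_on_eq_continuous_within has_vector_derivative_continuous)
  have "continuous_on {a..b} (\<lambda>t. w (\<gamma> t))"
    using continuous_on_compose2[OF w_cont \<gamma>_cont \<gamma>_in] .
  moreover have "w (\<gamma> t) \<noteq> 0" if "t \<in> {a..b}" for t
    using w_pos[of "\<gamma> t"] \<gamma>_in that by force
  ultimately have "continuous_on {a..b} k"
    unfolding k_def using D_cont by (intro continuous_intros) auto
  then have k_int: "k integrable_on {a..b}"
    by (rule integrable_continuous_interval)
  have hk: "h t = k t" if "t \<in> {a..b} - {a, b}" for t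
  proof -
    have t: "t \<in> interior {a..b}" "t \<in> {a..b}"
      using that by auto
    have "vector_derivative \<gamma> (at t) = D t"
      using D[OF t(2)] at_within_interior[OF t(1)] by (simp add: vector_derivative_at)
    then show ?thesis by (simp add: h_def k_def)
  qed
  show "h integrable_on {a..b}"
    using integrable_spike_finite[of "{a, b}" "{a..b}" h k] hk k_int by auto
  have int_eq: "integral {a..b} h = integral {a..b} k"
    using hk by (intro integral_spike[of "{a, b}"]) auto
  have fund: "((\<lambda>t. f' (\<gamma> t) (D t)) has_integral f (\<gamma> b) - f (\<gamma> a)) {a..b}"
  proof (rule fundamental_theorem_of_calculus)
    fix t assume t: "t \<in> {a..b}"
    then have deriv: "(f has_derivative f' (\<gamma> t)) (at (\<gamma> t))"
      using f' \<gamma>_in by blast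
    then have lin: "linear (f' (\<gamma> t))"
      by (simp add: has_derivative_linear)
    have "((\<lambda>s. f (\<gamma> s)) has_derivative (\<lambda>s. f' (\<gamma> t) (s *\<^sub>R D t))) (at t within {a..b})"
      using has_derivative_compose[OF D[OF t, unfolded has_vector_derivative_def] deriv] .
    then show "((\<lambda>t. f (\<gamma> t)) has_vector_derivative f' (\<gamma> t) (D t)) (at t within {a..b})"
      unfolding has_vector_derivative_def by (simp add: linear_cmul[OF lin])
  qed (use \<open>a < b\<close> in simp)
  have bound: "norm (f' (\<gamma> t) (D t)) \<le> B * k t" if t: "t \<in> {a..b}" for t
  proof -
    have \<gamma>t: "\<gamma> t \<in> \<Omega>"
      using \<gamma>_in t by auto
    have "norm (f' (\<gamma> t) (D t)) \<le> onorm (f' (\<gamma> t)) * norm (D t)"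
      using f'[OF \<gamma>t] by (intro onorm has_derivative_bounded_linear)
    also have "\<dots> \<le> B / w (\<gamma> t) * norm (D t)"
      using B[OF \<gamma>t] w_pos[OF \<gamma>t] by (intro mult_right_mono) (auto simp: field_simps)
    finally show ?thesis by (simp add: k_def)
  qed
  have "norm (f (\<gamma> b) - f (\<gamma> a)) = norm (integral {a..b} (\<lambda>t. f' (\<gamma> t) (D t)))"
    using fund by (simp add: integral_unique)
  also have "\<dots> \<le> integral {a..b} (\<lambda>t. B * k t)"
    using fund k_int bound
    by (intro integral_norm_bound_integral integrable_on_mult_right) (auto simp: integrable_on_def)
  also have "\<dots> = B * integral {a..b} h"
    by (simp add: int_eq)
  finally show "norm (f (\<gamma> b) - f (\<gamma> a)) \<le> B * integral {a..b} h" .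
qed

text \<open>
  The pieces add up by the triangle inequality on the left and additivity of the integral on the
  right. Integrability has to be carried along the induction, since additivity of the integral
  depends on it.
\<close>

lemma norm_diff_le_weighted_length:
  fixes f :: "'a::euclidean_space \<Rightarrow> 'b::euclidean_space" and \<gamma> :: "real \<Rightarrow> 'a"
  assumes \<gamma>: "piecewise_smooth_curve \<gamma>"
    and \<gamma>_in: "path_image \<gamma> \<subseteq> \<Omega>"
    and f': "\<And>\<zeta>. \<zeta> \<in> \<Omega> \<Longrightarrow> (f has_derivative f' \<zeta>) (at \<zeta>)"
    and w_cont: "continuous_on \<Omega> w"
    and w_pos: "\<And>\<zeta>. \<zeta> \<in> \<Omega> \<Longrightarrow> w \<zeta> > 0"
    and B: "\<And>\<zeta>. \<zeta> \<in> \<Omega> \<Longrightarrow> w \<zeta> * onorm (f' \<zeta>) \<le> B"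
  shows "norm (f (pathfinish \<gamma>) - f (pathstart \<gamma>)) \<le> B * weighted_length w \<gamma>"
proof -
  define h where "h = (\<lambda>t. norm (vector_derivative \<gamma> (at t)) / w (\<gamma> t))"
  obtain n p where p0: "p 0 = 0" and pn: "p n = 1" and
    pieces: "\<And>i. i < n \<Longrightarrow> p i < p (Suc i) \<and>
           (\<exists>D. continuous_on {p i..p (Suc i)} D \<and>
                (\<forall>t\<in>{p i..p (Suc i)}.
                   (\<gamma> has_vector_derivative D t) (at t within {p i..p (Suc i)})))"
    using \<gamma> unfolding piecewise_smooth_curve_def by blast
  have mono: "p i \<le> p j" if "i \<le> j" "j \<le> n" for i j
    using that
  proof (induction j rule: dec_induct)
    case (step j)
    then show ?case using pieces[of j] by force
  qed simp
  have "h integrable_on {0..p k} \<and> norm (f (\<gamma> (p k)) - f (\<gamma> 0)) \<le> B * integral {0..p k} h"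
    if "k \<le> n" for k
    using that
  proof (induction k)
    case 0
    then show ?case
      using integrable_on_refl[of h 0] by (simp add: p0)
  next
    case (Suc k)
    let ?I = "{p k..p (Suc k)}"
    have less: "p k < p (Suc k)" and ge: "0 \<le> p k" and le: "p (Suc k) \<le> 1"
      using pieces[of k] mono[of 0 k] mono[of "Suc k" n] p0 pn Suc.prems by auto
    obtain D where D: "continuous_on ?I D"
      "\<And>t. t \<in> ?I \<Longrightarrow> (\<gamma> has_vector_derivative D t) (at t within ?I)"
      using pieces[of k] Suc.prems by auto
    have "\<gamma> ` ?I \<subseteq> \<Omega>"
      using \<gamma>_in ge le by (force simp: path_image_def)
    then have piece: "h integrable_on ?I"
        "norm (f (\<gamma> (p (Suc k))) - f (\<gamma> (p k))) \<le> B * integral ?I h"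
      using norm_diff_le_weighted_length_piece[OF less D _ f' w_cont w_pos B]
      unfolding h_def by blast+
    have h_int: "h integrable_on {0..p (Suc k)}"
      using Henstock_Kurzweil_Integration.integrable_combine[OF ge, of "p (Suc k)" h]
        Suc piece(1) less by simp
    have "norm (f (\<gamma> (p (Suc k))) - f (\<gamma> 0))
        \<le> norm (f (\<gamma> (p k)) - f (\<gamma> 0)) + norm (f (\<gamma> (p (Suc k))) - f (\<gamma> (p k)))"
      by (metis add.commute diff_add_cancel diff_diff_eq2 norm_triangle_ineq)
    also have "\<dots> \<le> B * integral {0..p k} h + B * integral ?I h"
      using Suc piece(2) by (intro add_mono) auto
    also have "\<dots> = B * integral {0..p (Suc k)} h"
      using Henstock_Kurzweil_Integration.integral_combine[OF ge _ h_int] less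
      by (simp flip: distrib_left)
    finally show ?case using h_int by simp
  qed
  from this[of n] show ?thesis
    by (simp add: pn weighted_length_def h_def pathfinish_def pathstart_def)
qed

section \<open>Increments and the weighted distance\<close>

text \<open>
  The infimum defining the weighted distance must range over a nonempty set to be meaningful. Points
  of a domain can even be joined by a polynomial curve, which consists of one smooth piece.
\<close>

lemma domain_piecewise_smooth_connected:
  fixes \<Omega> :: "'a::euclidean_space set"
  assumes "is_domain \<Omega>" "\<zeta> \<in> \<Omega>" "\<eta> \<in> \<Omega>"
  obtains \<gamma> where "piecewise_smooth_curve \<gamma>" "path_image \<gamma> \<subseteq> \<Omega>"
    "pathstart \<gamma> = \<zeta>" "pathfinish \<gamma> = \<eta>"
proof -
  obtain \<gamma> where \<gamma>: "polynomial_function \<gamma>" "path_image \<gamma> \<subseteq> \<Omega>"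
    "pathstart \<gamma> = \<zeta>" "pathfinish \<gamma> = \<eta>"
    using connected_open_polynomial_connected assms unfolding is_domain_def by metis
  obtain D where D: "polynomial_function D" "\<And>t. (\<gamma> has_vector_derivative D t) (at t)"
    using has_vector_derivative_polynomial_function[OF \<gamma>(1)] by metis
  have "continuous_on {0..1} D"
    using D(1) by (rule continuous_on_polymonial_function)
  moreover have "\<forall>t\<in>{0..1}. (\<gamma> has_vector_derivative D t) (at t within {0..1})"
    using D(2) by (blast intro: has_vector_derivative_at_within)
  ultimately have "\<exists>D. continuous_on {real 0..real (Suc 0)} D \<and>
      (\<forall>t\<in>{real 0..real (Suc 0)}.
        (\<gamma> has_vector_derivative D t) (at t within {real 0..real (Suc 0)}))"
    by (intro exI[of _ D]) simp
  then have "piecewise_smooth_curve \<gamma>"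
    unfolding piecewise_smooth_curve_def
    by (intro exI[of _ "Suc 0"] exI[of _ real]) simp
  with \<gamma> that show ?thesis by blast
qed

lemma norm_diff_le_weighted_dist:
  fixes f :: "'a::euclidean_space \<Rightarrow> 'b::euclidean_space"
  assumes dom: "is_domain \<Omega>"
    and "\<zeta> \<in> \<Omega>" "\<eta> \<in> \<Omega>"
    and f': "\<And>\<zeta>. \<zeta> \<in> \<Omega> \<Longrightarrow> (f has_derivative f' \<zeta>) (at \<zeta>)"
    and w_cont: "continuous_on \<Omega> w"
    and w_pos: "\<And>\<zeta>. \<zeta> \<in> \<Omega> \<Longrightarrow> w \<zeta> > 0"
    and B: "\<And>\<zeta>. \<zeta> \<in> \<Omega> \<Longrightarrow> w \<zeta> * onorm (f' \<zeta>) \<le> B"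
  shows "norm (f \<zeta> - f \<eta>) \<le> B * weighted_dist \<Omega> w \<zeta> \<eta>"
proof -
  let ?S = "{weighted_length w \<gamma> | \<gamma>. piecewise_smooth_curve \<gamma> \<and> path_image \<gamma> \<subseteq> \<Omega> \<and>
               pathstart \<gamma> = \<zeta> \<and> pathfinish \<gamma> = \<eta>}"
  have le: "norm (f \<zeta> - f \<eta>) \<le> B * s" if "s \<in> ?S" for s
    using that norm_diff_le_weighted_length[OF _ _ f' w_cont w_pos B]
    by (auto simp: norm_minus_commute)
  have ne: "?S \<noteq> {}"
    using domain_piecewise_smooth_connected[OF dom \<open>\<zeta> \<in> \<Omega>\<close> \<open>\<eta> \<in> \<Omega>\<close>] by blast
  have "0 \<le> w \<zeta> * onorm (f' \<zeta>)"
    using w_pos f' \<open>\<zeta> \<in> \<Omega>\<close>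
    by (intro mult_nonneg_nonneg onorm_pos_le has_derivative_bounded_linear) (auto intro: less_imp_le)
  \<comment> \<open>Dividing by \<open>B\<close> moves the estimate inside the infimum; if \<open>B = 0\<close>, then the estimate along a
    single curve already gives \<open>f \<zeta> = f \<eta>\<close>.\<close>
  then consider "B = 0" | "B > 0"
    using B[OF \<open>\<zeta> \<in> \<Omega>\<close>] by linarith
  then show ?thesis
  proof cases
    case 1
    then show ?thesis using le ne by fastforce
  next
    case 2
    have "norm (f \<zeta> - f \<eta>) / B \<le> Inf ?S"
      using ne le 2 by (intro cInf_greatest) (auto simp: field_simps)
    then show ?thesis
      using 2 by (simp add: weighted_dist_def field_simps)
  qed
qed

lemma lipschitz_norm_le_bloch_norm:
  fixes f :: "'a::euclidean_space \<Rightarrow> 'b::euclidean_space"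
  assumes dom: "is_domain \<Omega>"
    and diff: "\<And>\<zeta>. \<zeta> \<in> \<Omega> \<Longrightarrow> f differentiable (at \<zeta>)"
    and w_cont: "continuous_on \<Omega> w"
    and w_pos: "\<And>\<zeta>. \<zeta> \<in> \<Omega> \<Longrightarrow> w \<zeta> > 0"
    and adm: "admissible \<Omega> w W"
  shows "lipschitz_norm \<Omega> W f \<le> bloch_norm \<Omega> w f"
proof (rule ereal_le_real)
  fix B assume "bloch_norm \<Omega> w f \<le> ereal B"
  then have B: "w \<zeta> * onorm (frechet_derivative f (at \<zeta>)) \<le> B" if "\<zeta> \<in> \<Omega>" for \<zeta>
    using that unfolding bloch_norm_def SUP_le_iff by auto
  have deriv: "(f has_derivative frechet_derivative f (at \<zeta>)) (at \<zeta>)" if "\<zeta> \<in> \<Omega>" for \<zeta>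
    using diff[OF that] by (simp add: frechet_derivative_works)
  have "W \<zeta> \<eta> * (norm (f \<zeta> - f \<eta>) / norm (\<zeta> - \<eta>)) \<le> B"
    if \<zeta>\<eta>: "\<zeta> \<in> \<Omega>" "\<eta> \<in> \<Omega>" "\<zeta> \<noteq> \<eta>" for \<zeta> \<eta>
  proof -
    have W: "W \<zeta> \<eta> > 0" "weighted_dist \<Omega> w \<zeta> \<eta> * W \<zeta> \<eta> \<le> norm (\<zeta> - \<eta>)"
      using adm \<zeta>\<eta> unfolding admissible_def by auto
    have "0 \<le> w \<zeta> * onorm (frechet_derivative f (at \<zeta>))"
      using w_pos deriv \<zeta>\<eta>
      by (intro mult_nonneg_nonneg onorm_pos_le has_derivative_bounded_linear) (auto intro: less_imp_le)
    then have "B \<ge> 0"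
      using B[OF \<zeta>\<eta>(1)] by linarith
    have "W \<zeta> \<eta> * norm (f \<zeta> - f \<eta>) \<le> W \<zeta> \<eta> * (B * weighted_dist \<Omega> w \<zeta> \<eta>)"
      using norm_diff_le_weighted_dist[OF dom \<zeta>\<eta>(1,2) deriv w_cont w_pos B] W(1)
      by (intro mult_left_mono) auto
    also have "\<dots> \<le> B * norm (\<zeta> - \<eta>)"
      using mult_left_mono[OF W(2) \<open>B \<ge> 0\<close>] by (simp add: algebra_simps)
    finally show ?thesis
      using \<zeta>\<eta>(3) by (simp add: field_simps)
  qed
  then show "lipschitz_norm \<Omega> W f \<le> ereal B"
    unfolding lipschitz_norm_def SUP_le_iff by auto
qed

section \<open>Equality of the two norms\<close>

theorem theorem1p2:
  fixes \<Omega> :: "(real ^ 'm) set"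
    and f :: "real ^ 'm \<Rightarrow> real ^ 'n"
    and w :: "real ^ 'm \<Rightarrow> real"
    and W :: "real ^ 'm \<Rightarrow> real ^ 'm \<Rightarrow> real"
  assumes "is_domain \<Omega>"
    and "C1_map_on f \<Omega>"
    and "continuous_on \<Omega> w"
    and "\<forall>\<zeta>\<in>\<Omega>. w \<zeta> > 0"
    and "admissible \<Omega> w W"
    and "\<bar>bloch_norm \<Omega> w f\<bar> \<noteq> \<infinity> \<or> \<bar>lipschitz_norm \<Omega> W f\<bar> \<noteq> \<infinity>"
  shows "\<bar>bloch_norm \<Omega> w f\<bar> \<noteq> \<infinity> \<and> \<bar>lipschitz_norm \<Omega> W f\<bar> \<noteq> \<infinity> \<and>
         bloch_norm \<Omega> w f = lipschitz_norm \<Omega> W f"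
proof -
  have "f differentiable (at \<zeta>)" if "\<zeta> \<in> \<Omega>" for \<zeta>
    using assms(2) that unfolding C1_map_on_def by (blast intro: differentiableI)
  then have "bloch_norm \<Omega> w f = lipschitz_norm \<Omega> W f"
    using assms(1,3,4,5)
    by (intro antisym bloch_norm_le_lipschitz_norm lipschitz_norm_le_bloch_norm)
      (auto simp: is_domain_def)
  with assms(6) show ?thesis by auto
qed

end
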